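(* Let $X$ be a real Banach space with dual $X^*$ and bidual $X^{**}$, where $X$ is identified with its canonical image in $X^{**}$. Let $A\colon X^*\to X^{**}$ be linear and continuous. Assume that $\operatorname{ran}A\subseteq X$ and that there exists $e\in X^{**}\setminus X$ such that $\|e\|<\frac{1}{\sqrt2}$ and $$\langle Ax^*,x^*\rangle=\langle e,x^*\rangle^2\quad\text{for all }x^*\in X^*.$$ Let $S$ be the skew part of $A$, and let $T\colon X\rightrightarrows X^*$ be defined by $$\operatorname{gra}T:=\{(-Sx^*,x^* )\mid x^*\in X^*,\ \langle e,x^*\rangle=0\}=\{(-Ax^*,x^* )\mid x^*\in X^*,\ \langle e,x^*\rangle=0\}.$$ Let $\mathcal{B}_T\colon X\times X^*\to\,]-\infty,+\infty]$ be the function associated with $T$ that is defined in the context. Then $$\mathcal{B}_T(-Aa^*,a^* )>\mathcal{B}_T^*(a^*,-Aa^* )\quad\text{for all }a^*\in X^*\text{ with }\langle e,a^*\rangle\neq 0.$$ In consequence, $\mathcal{B}_T$ is not autoconjugate.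
   Context: A set-valued operator $T\colon X\rightrightarrows X^*$ assigns to each $x\in X$ a set $Tx\subseteq X^*$, and $\operatorname{gra}T:=\{(x,x^* )\in X\times X^*\mid x^*\in Tx\}$. Here $\langle\cdot,\cdot\rangle$ denotes the duality pairings (between $X$ and $X^*$, and between $X^{**}$ and $X^*$), and the norms on $X^*$ and $X^{**}$ are the dual and second dual norms. Skew part: for a continuous linear $A\colon X^*\to X^{**}$, let $A^*$ be its adjoint, which on elements $x^*\in X^*$ (viewed in $X^{***}$) is given by $\langle A^*x^*,y^*\rangle=\langle Ay^*,x^*\rangle$ for all $y^*\in X^*$, so that $A^*x^*\in X^{**}$. The skew part of $A$ is $S:=\frac12A-\frac12A^*$ on $X^*$. Conjugates: for $F\colon X\times X^*\to\,]-\infty,+\infty]$, the Fenchel conjugate $F^*\colon X^*\times X^{**}\to[-\infty,+\infty]$ is $$F^*(x^*,x^{**}):=\sup_{(y,y^* )\in X\times X^*}\{\langle x^*,y\rangle+\langle x^{**},y^*\rangle-F(y,y^* )\}.$$ The transpose is defined by $F^{*\intercal}(x^{**},x^* ):=F^*(x^*,x^{**})$. In particular, $F^{*\intercal}(x,x^* )=F^*(x^*,x)$ for $(x,x^* )\in X\times X^*$. The function $F$ is called autoconjugate if $F=F^{*\intercal}$ on $X\times X^*$. Fitzpatrick function: for $T\colon X\rightrightarrows X^*$, $F_T\colon X\times X^*\to\,]-\infty,+\infty]$ is $$F_T(x,x^* ):=\sup_{(a,a^* )\in\operatorname{gra}T}\left(\langle x,a^*\rangle+\langle a,x^*\rangle-\langle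 a,a^*\rangle\right).$$ The function $\mathcal{B}_T$ is defined for $(x,x^* )\in X\times X^*$ by $$\mathcal{B}_T(x,x^* ):=\inf_{(y,y^* )\in X\times X^*}\left\{\tfrac12F_T(x+y,x^*+y^* )+\tfrac12F_T^{*\intercal}(x-y,x^*-y^* )+\tfrac12\|y\|^2+\tfrac12\|y^*\|^2\right\}.$$ *)

theory Defs
  imports "HOL-Analysis.Analysis"
begin

type_synonym 'a dual = "'a \<Rightarrow>\<^sub>L real"

definition canon :: "'a::real_normed_vector \<Rightarrow> 'a dual dual"
  where "canon x = Blinfun (\<lambda>f. blinfun_apply f x)"

lemma canon_apply [simp]: "blinfun_apply (canon x) f = blinfun_apply f x"
  unfolding canon_def
  by (rule bounded_linear_Blinfun_apply[THEN fun_cong])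
     (rule bounded_bilinear.bounded_linear_left[OF bounded_bilinear_blinfun_apply])

definition dual_adjoint ::
    "('a::real_normed_vector \<Rightarrow>\<^sub>L 'b::real_normed_vector) \<Rightarrow> 'b dual \<Rightarrow> 'a dual"
  where "dual_adjoint A \<phi> = \<phi> o\<^sub>L A"

definition skew_part ::
    "('a::real_normed_vector dual \<Rightarrow>\<^sub>L 'a dual dual) \<Rightarrow> 'a dual \<Rightarrow> 'a dual dual"
  where "skew_part A xs = (1/2) *\<^sub>R A xs - (1/2) *\<^sub>R dual_adjoint A (canon xs)"

lemma dual_adjoint_canon_apply:
  fixes A :: "'a::real_normed_vector dual \<Rightarrow>\<^sub>L 'a dual dual"
  shows "blinfun_apply (dual_adjoint A (canon xs)) ys = blinfun_apply (A ys) xs"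
  by (simp add: dual_adjoint_def)

definition gra :: "('a::real_normed_vector \<Rightarrow> 'a dual set) \<Rightarrow> ('a \<times> 'a dual) set"
  where "gra T = {(x, xs). xs \<in> T x}"

definition conjugate ::
    "('a::real_normed_vector \<Rightarrow> 'a dual \<Rightarrow> ereal) \<Rightarrow> 'a dual \<Rightarrow> 'a dual dual \<Rightarrow> ereal"
  where "conjugate F xs xss =
    (SUP (y, ys) \<in> UNIV. ereal (blinfun_apply xs y + blinfun_apply xss ys) - F y ys)"

definition conjugate_transpose ::
    "('a::real_normed_vector \<Rightarrow> 'a dual \<Rightarrow> ereal) \<Rightarrow> 'a dual dual \<Rightarrow> 'a dual \<Rightarrow> ereal"
  where "conjugate_transpose F xss xs = conjugate F xs xss"

definition autoconjugate :: "('a::real_normed_vector \<Rightarrow> 'a dual \<Rightarrow> ereal) \<Rightarrow> bool"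
  where "autoconjugate F \<longleftrightarrow> (\<forall>x xs. F x xs = conjugate_transpose F (canon x) xs)"

definition fitzpatrick ::
    "('a::real_normed_vector \<Rightarrow> 'a dual set) \<Rightarrow> 'a \<Rightarrow> 'a dual \<Rightarrow> ereal"
  where "fitzpatrick T x xs =
    (SUP (a, as) \<in> gra T.
       ereal (blinfun_apply as x + blinfun_apply xs a - blinfun_apply as a))"

text \<open>
  The \<^typ>\<open>ereal\<close> sum below is only of interest when neither Fitzpatrick term takes the
  value \<open>-\<infinity>\<close>, e.g. when \<open>T\<close> is monotone with nonempty graph; the convention
  \<open>\<infinity> + -\<infinity> = \<infinity>\<close> is then never invoked.
\<close>

definition B_fun ::
    "('a::real_normed_vector \<Rightarrow> 'a dual set) \<Rightarrow> 'a \<Rightarrow> 'a dual \<Rightarrow> ereal"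
  where "B_fun T x xs =
    (INF (y, ys) \<in> UNIV.
       ereal (1/2) * fitzpatrick T (x + y) (xs + ys)
       + ereal (1/2) * conjugate_transpose (fitzpatrick T) (canon (x - y)) (xs - ys)
       + ereal ((1/2) * (norm y)\<^sup>2) + ereal ((1/2) * (norm ys)\<^sup>2))"

text \<open>
  The operator with graph \<open>{(-S x\<^sup>*, x\<^sup>*) | \<langle>e, x\<^sup>*\<rangle> = 0}\<close>, where \<open>S\<close> is the skew part of \<open>A\<close>.
  Taken literally, these pairs lie in \<open>X\<^sup>*\<^sup>* \<times> X\<^sup>*\<close>, so the first component is pulled back along
  the injection \<^const>\<open>canon\<close>. No pair is lost when every such \<open>S x\<^sup>*\<close> lies in the range
  of \<^const>\<open>canon\<close>.
\<close>

definition skew_op ::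
    "('a::real_normed_vector dual \<Rightarrow>\<^sub>L 'a dual dual) \<Rightarrow> 'a dual dual \<Rightarrow> 'a \<Rightarrow> 'a dual set"
  where "skew_op A e x = {xs. canon x = - skew_part A xs \<and> blinfun_apply e xs = 0}"

end

theory Submission
  imports Defs
begin

text \<open>
  Polarizing \<open>\<langle>Ax\<^sup>*, x\<^sup>*\<rangle> = \<langle>e, x\<^sup>*\<rangle>\<^sup>2\<close> gives \<open>A + A\<^sup>* = 2 e \<otimes> e\<close>. As \<open>ran A \<subseteq> X\<close> and
  \<open>e \<notin> X\<close>, it follows that \<open>F\<^sub>T\<close> is the indicator of the graph of \<open>-A\<close> and that the transposed
  conjugate of \<open>F\<^sub>T\<close> is, on \<open>X \<times> X\<^sup>*\<close>, the indicator of the graph of \<open>T\<close>. So \<open>B\<^sub>T\<close> is infinite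
  off the graph of \<open>-A\<close>, and on it
  \<open>B\<^sub>T(-Ax\<^sup>*, x\<^sup>*) \<ge> inf {\<parallel>y\<^sup>*\<parallel>\<^sup>2 / 2 | \<langle>e, y\<^sup>*\<rangle> = \<langle>e, x\<^sup>*\<rangle>} \<ge> c \<langle>e, x\<^sup>*\<rangle>\<^sup>2\<close> with
  \<open>c = 1 / (2 \<parallel>e\<parallel>\<^sup>2) > 1\<close>. With \<open>s = \<langle>e, a\<^sup>*\<rangle>\<close> this bounds the conjugate at \<open>(a\<^sup>*, -Aa\<^sup>*)\<close> by
  \<open>sup\<^sub>t (-2st - t\<^sup>2) = s\<^sup>2 < c s\<^sup>2\<close>.
\<close>

section \<open>The canonical embedding and bounded functionals\<close>

lemma canon_add: "canon (x + y) = canon x + canon y"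
  by (rule blinfun_eqI) (simp add: blinfun.bilinear_simps)

lemma canon_diff: "canon (x - y) = canon x - canon y"
  by (rule blinfun_eqI) (simp add: blinfun.bilinear_simps)

lemma canon_scaleR: "canon (r *\<^sub>R x) = r *\<^sub>R canon x"
  by (rule blinfun_eqI) (simp add: blinfun.bilinear_simps)

lemma canon_minus: "canon (- x) = - canon x"
  by (rule blinfun_eqI) (simp add: blinfun.bilinear_simps)

text \<open>Used contrapositively: since \<open>e\<close> lies outside X, its only multiple inside X
  is 0.\<close>

lemma range_canon_scaleR_cancel:
  assumes "r *\<^sub>R e \<in> range canon" "r \<noteq> 0"
  shows "e \<in> range canon"
proof -
  obtain x where "r *\<^sub>R e = canon x" using assms(1) by blast
  then have "e = canon ((1 / r) *\<^sub>R x)"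
    unfolding canon_scaleR using assms(2) by (metis scaleR_left_imp_eq scaleR_scaleR
      nonzero_eq_divide_eq mult.commute scaleR_one)
  then show ?thesis by blast
qed

text \<open>Here \<open>v\<close> will be a nonzero value of a linear functional: along that line
  the functional is unbounded, so any supremum dominating it is infinite.\<close>

lemma ereal_eq_infinity_of_scaled:
  fixes M :: ereal
  assumes "v \<noteq> 0" and "\<And>r. ereal (r * v) \<le> M"
  shows "M = \<infinity>"
proof (rule ereal_top)
  fix B
  show "ereal B \<le> M" using assms(2)[of "B / v"] assms(1) by simp
qed

lemma blinfun_eq_scaleR_of_vanish_on_kernel:
  fixes e \<phi> :: "'a::real_normed_vector \<Rightarrow>\<^sub>L real"
  assumes "e \<noteq> 0" and vanish: "\<And>b. e b = 0 \<Longrightarrow> \<phi> b = 0"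
  obtains r where "\<phi> = r *\<^sub>R e"
proof -
  obtain b0 where b0: "e b0 \<noteq> 0"
    using \<open>e \<noteq> 0\<close> by (metis blinfun_eqI zero_blinfun.rep_eq)
  have "\<phi> = (\<phi> b0 / e b0) *\<^sub>R e"
  proof (rule blinfun_eqI)
    fix x
    \<comment> \<open>Subtracting the component along \<open>b0\<close> projects \<open>x\<close>
      onto the kernel of \<open>e\<close>.\<close>
    have "\<phi> (x - (e x / e b0) *\<^sub>R b0) = 0"
      by (rule vanish) (simp add: blinfun.bilinear_simps b0)
    then show "\<phi> x = ((\<phi> b0 / e b0) *\<^sub>R e) x"
      by (simp add: blinfun.bilinear_simps mult.commute)
  qed
  then show ?thesis by (rule that)
qed

lemma two_norm_power2_less_one:
  assumes "norm (e :: 'a::real_normed_vector) < 1 / sqrt 2"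
  shows "2 * (norm e)\<^sup>2 < 1"
proof -
  have "(norm e)\<^sup>2 < (1 / sqrt 2)\<^sup>2"
    using assms by (intro power_strict_mono) auto
  then show ?thesis by (simp add: power_divide)
qed

section \<open>Operators whose symmetric part has rank one\<close>

locale rank_one_symmetric_part =
  fixes A :: "'a::real_normed_vector dual \<Rightarrow>\<^sub>L 'a dual dual"
    and e :: "'a dual dual"
  assumes ran_A: "range (blinfun_apply A) \<subseteq> range canon"
    and e_notin: "e \<notin> range canon"
    and A_e: "\<And>xs. blinfun_apply (blinfun_apply A xs) xs = (blinfun_apply e xs)\<^sup>2"
begin

lemma e_nonzero: "e \<noteq> 0"
proof
  assume "e = 0"
  then have "e = canon 0" by (simp add: blinfun_eqI)
  then show False using e_notin by blast
qed

lemma A_polar: "A x y + A y x = 2 * e x * e y"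
  using A_e[of "x + y"] A_e[of x] A_e[of y]
  by (simp add: blinfun.bilinear_simps power2_eq_square algebra_simps)

lemma adjoint_canon: "dual_adjoint A (canon x) = (2 * e x) *\<^sub>R e - A x"
  using A_polar by (intro blinfun_eqI)
    (simp add: dual_adjoint_canon_apply blinfun.bilinear_simps eq_diff_eq add.commute)

text \<open>The correction vanishes on the kernel of \<open>e\<close>, which is why the two
  descriptions of the graph of T coincide.\<close>

lemma skew_part_eq: "skew_part A x = A x - e x *\<^sub>R e"
  unfolding skew_part_def adjoint_canon
  by (rule blinfun_eqI) (simp add: blinfun.bilinear_simps field_simps)

lemma canon_preimage:
  obtains x where "canon x = - A xs"
proof -
  obtain x where "A xs = canon x" using ran_A by blast
  then have "canon (- x) = - A xs" by (simp add: canon_minus)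
  then show ?thesis by (rule that)
qed

lemma gra_skew_op: "(x, xs) \<in> gra (skew_op A e) \<longleftrightarrow> canon x = - A xs \<and> e xs = 0"
  by (auto simp: gra_def skew_op_def skew_part_eq)

section \<open>The Fitzpatrick function of T\<close>

lemma apply_graph:
  assumes "canon y = - A ys"
  shows "blinfun_apply b y = - A ys b"
  using arg_cong[OF assms, of "\<lambda>f. blinfun_apply f b"] by (simp add: blinfun.bilinear_simps)

text \<open>This is exactly the contribution of the graph point (-Ab, b): for \<open>b\<close> in
  the kernel of \<open>e\<close> its quadratic term is \<open>(e b)\<^sup>2\<close> = 0, and
  polarization turns \<open>- A b xs\<close> into \<open>A xs b\<close>. The bound is thus linear in
  \<open>b\<close>.\<close>

lemma fitzpatrick_lower:
  assumes "e b = 0"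
  shows "ereal ((canon x + A xs) b) \<le> fitzpatrick (skew_op A e) x xs"
proof -
  obtain a where a: "canon a = - A b" by (rule canon_preimage)
  have "(canon x + A xs) b = b x + xs a - b a"
    using A_polar[of xs b] A_e[of b] assms
    by (simp add: apply_graph[OF a] blinfun.bilinear_simps)
  then show ?thesis
    unfolding fitzpatrick_def using a assms
    by (intro SUP_upper2[of "(a, b)"]) (auto simp: gra_skew_op)
qed

lemma fitzpatrick_nonneg: "0 \<le> fitzpatrick (skew_op A e) x xs"
  using fitzpatrick_lower[of 0 x xs] by (simp add: blinfun.bilinear_simps zero_ereal_def)

lemma fitzpatrick_off_graph:
  assumes "canon x \<noteq> - A xs"
  shows "fitzpatrick (skew_op A e) x xs = \<infinity>"
proof -
  let ?\<phi> = "canon x + A xs"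
  have "\<exists>b. e b = 0 \<and> ?\<phi> b \<noteq> 0"
  proof (rule ccontr)
    assume "\<not> ?thesis"
    \<comment> \<open>Vanishing on the kernel makes the functional a multiple of \<open>e\<close>.
      It also lies in X because \<open>A\<close> maps into X, so the multiple must be 0.\<close>
    then obtain r where r: "?\<phi> = r *\<^sub>R e"
      using blinfun_eq_scaleR_of_vanish_on_kernel[OF e_nonzero] by metis
    obtain a where "canon a = - A xs" by (rule canon_preimage)
    then have "r *\<^sub>R e = canon (x - a)" using r by (simp add: canon_diff)
    then have "r = 0" using range_canon_scaleR_cancel e_notin by blast
    then show False using r assms by (simp add: eq_neg_iff_add_eq_0)
  qed
  then obtain b where b: "e b = 0" "?\<phi> b \<noteq> 0" by blast
  show ?thesis
  proof (rule ereal_eq_infinity_of_scaled[OF b(2)])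
    fix r
    show "ereal (r * ?\<phi> b) \<le> fitzpatrick (skew_op A e) x xs"
      using fitzpatrick_lower[of "r *\<^sub>R b" x xs] b(1)
      by (simp add: blinfun.bilinear_simps distrib_left)
  qed
qed

lemma fitzpatrick_on_graph:
  assumes "canon y = - A ys"
  shows "fitzpatrick (skew_op A e) y ys \<le> 0"
  unfolding fitzpatrick_def
proof (rule SUP_least, clarify)
  fix a b assume "(a, b) \<in> gra (skew_op A e)"
  then have a: "canon a = - A b" and b: "e b = 0" by (auto simp: gra_skew_op)
  \<comment> \<open>By polarization the expression is -2 \<open>e ys\<close> \<open>e b\<close> +
    \<open>(e b)\<^sup>2\<close>, which vanishes with \<open>e b\<close>.\<close>
  show "ereal (b y + ys a - b a) \<le> 0"
    using A_polar[of ys b] A_e[of b] b by (simp add: apply_graph[OF assms] apply_graph[OF a])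
qed

section \<open>The conjugate of the Fitzpatrick function\<close>

lemma conjugate_lower:
  "ereal ((xss - dual_adjoint A (canon xs)) ys)
    \<le> conjugate_transpose (fitzpatrick (skew_op A e)) xss xs"
proof -
  \<comment> \<open>The supremum is tested on the whole graph of -A, where the Fitzpatrick function
    is 0. Here \<open>ys\<close> is not confined to the kernel of \<open>e\<close>, so finiteness of
    the conjugate forces the functional to vanish everywhere.\<close>
  obtain y where y: "canon y = - A ys" by (rule canon_preimage)
  have "(xss - dual_adjoint A (canon xs)) ys = xs y + xss ys"
    by (simp add: apply_graph[OF y] dual_adjoint_canon_apply blinfun.bilinear_simps)
  moreover have "fitzpatrick (skew_op A e) y ys = 0"
    using fitzpatrick_on_graph[OF y] fitzpatrick_nonneg by (rule antisym)
  ultimately show ?thesis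
    unfolding conjugate_transpose_def conjugate_def
    by (intro SUP_upper2[of "(y, ys)"]) auto
qed

lemma conjugate_nonneg: "0 \<le> conjugate_transpose (fitzpatrick (skew_op A e)) xss xs"
  using conjugate_lower[of xss xs 0] by (simp add: blinfun.bilinear_simps zero_ereal_def)

lemma conjugate_off_graph:
  assumes "\<not> (canon x = - A xs \<and> e xs = 0)"
  shows "conjugate_transpose (fitzpatrick (skew_op A e)) (canon x) xs = \<infinity>"
proof -
  let ?\<phi> = "canon x - dual_adjoint A (canon xs)"
  have "?\<phi> \<noteq> 0"
  proof
    assume 0: "?\<phi> = 0"
    then have eq: "canon x = (2 * e xs) *\<^sub>R e - A xs" by (simp add: adjoint_canon)
    obtain a where "canon a = - A xs" by (rule canon_preimage)
    then have "(2 * e xs) *\<^sub>R e = canon (x - a)" using eq by (simp add: canon_diff)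
    \<comment> \<open>This is how the extra condition \<open>e xs = 0\<close> arises: a nonzero
      multiple of \<open>e\<close> cannot lie in X.\<close>
    then have "2 * e xs = 0" using range_canon_scaleR_cancel e_notin by blast
    then show False using eq assms by simp
  qed
  then obtain b where b: "?\<phi> b \<noteq> 0" by (metis blinfun_eqI zero_blinfun.rep_eq)
  show ?thesis
  proof (rule ereal_eq_infinity_of_scaled[OF b])
    fix r
    show "ereal (r * ?\<phi> b) \<le> conjugate_transpose (fitzpatrick (skew_op A e)) (canon x) xs"
      using conjugate_lower[of "canon x" xs "r *\<^sub>R b"]
      by (simp add: blinfun.bilinear_simps)
  qed
qed

section \<open>Bounds for the function B_T and its conjugate\<close>

lemma B_term_lower:
  fixes x y :: 'a and xs ys :: "'a dual"
  defines "L \<equiv> ereal (1/2) * fitzpatrick (skew_op A e) (x + y) (xs + ys)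
       + ereal (1/2) * conjugate_transpose (fitzpatrick (skew_op A e)) (canon (x - y)) (xs - ys)
       + ereal ((1/2) * (norm y)\<^sup>2) + ereal ((1/2) * (norm ys)\<^sup>2)"
  shows "canon x = - A xs \<and> e ys = e xs \<and> ereal ((1/2) * (norm ys)\<^sup>2) \<le> L \<or> L = \<infinity>"
proof -
  let ?F = "fitzpatrick (skew_op A e) (x + y) (xs + ys)"
  let ?G = "conjugate_transpose (fitzpatrick (skew_op A e)) (canon (x - y)) (xs - ys)"
  have F: "0 \<le> ?F" and G: "0 \<le> ?G" by (rule fitzpatrick_nonneg, rule conjugate_nonneg)
  have F': "0 \<le> ereal (1/2) * ?F" and G': "0 \<le> ereal (1/2) * ?G"
    using F G by (simp_all add: ereal_zero_le_0_iff)
  show ?thesis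
  proof (cases "L = \<infinity>")
    case False
    then have "?F \<noteq> \<infinity>" "?G \<noteq> \<infinity>"
      using F' G' by (auto simp: L_def)
    then have 1: "canon (x + y) = - A (xs + ys)"
      and 2: "canon (x - y) = - A (xs - ys)" and 3: "e (xs - ys) = 0"
      using fitzpatrick_off_graph conjugate_off_graph by blast+
    \<comment> \<open>The graph of -A is a linear subspace, so it contains the midpoint of the two
      points just found.\<close>
    have "2 *\<^sub>R canon x = canon (x + y) + canon (x - y)"
      by (simp add: canon_add canon_diff scaleR_2)
    also have "\<dots> = 2 *\<^sub>R (- A xs)"
      unfolding 1 2 by (simp add: blinfun.bilinear_simps scaleR_2)
    finally have "canon x = - A xs" by (simp only: scaleR_cancel_left) simp
    moreover have "e ys = e xs" using 3 by (simp add: blinfun.bilinear_simps)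
    moreover have "0 + 0 + ereal 0 + ereal ((1/2) * (norm ys)\<^sup>2) \<le> L"
      unfolding L_def using F' G' by (intro add_mono) auto
    ultimately show ?thesis by simp
  qed simp
qed

lemma B_fun_off_graph:
  assumes "canon x \<noteq> - A xs"
  shows "B_fun (skew_op A e) x xs = \<infinity>"
proof -
  have "\<infinity> \<le> B_fun (skew_op A e) x xs"
    unfolding B_fun_def
  proof (rule INF_greatest, clarify)
    fix y :: 'a and ys
    show "\<infinity> \<le> ereal (1/2) * fitzpatrick (skew_op A e) (x + y) (xs + ys)
       + ereal (1/2) * conjugate_transpose (fitzpatrick (skew_op A e)) (canon (x - y)) (xs - ys)
       + ereal ((1/2) * (norm y)\<^sup>2) + ereal ((1/2) * (norm ys)\<^sup>2)"
      using B_term_lower[where x = x and y = y and xs = xs and ys = ys] assms by simp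
  qed
  then show ?thesis by simp
qed

lemma B_fun_lower: "ereal ((e xs)\<^sup>2 / (2 * (norm e)\<^sup>2)) \<le> B_fun (skew_op A e) x xs"
  unfolding B_fun_def
proof (rule INF_greatest, clarify)
  fix y :: 'a and ys
  let ?L = "ereal (1/2) * fitzpatrick (skew_op A e) (x + y) (xs + ys)
       + ereal (1/2) * conjugate_transpose (fitzpatrick (skew_op A e)) (canon (x - y)) (xs - ys)
       + ereal ((1/2) * (norm y)\<^sup>2) + ereal ((1/2) * (norm ys)\<^sup>2)"
  consider "?L = \<infinity>" | "e ys = e xs" "ereal ((1/2) * (norm ys)\<^sup>2) \<le> ?L"
    using B_term_lower[where x = x and y = y and xs = xs and ys = ys] by blast
  then show "ereal ((e xs)\<^sup>2 / (2 * (norm e)\<^sup>2)) \<le> ?L"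
  proof cases
    case 1
    show ?thesis unfolding 1 by simp
  next
    case 2
    \<comment> \<open>The constraint \<open>e ys = e xs\<close> and the dual norm inequality bound
      \<open>norm ys\<close> from below.\<close>
    have "(e ys)\<^sup>2 \<le> (norm e * norm ys)\<^sup>2"
      using norm_blinfun[of e ys] by (simp add: abs_le_square_iff[symmetric])
    then have "(e xs)\<^sup>2 / (2 * (norm e)\<^sup>2) \<le> (1/2) * (norm ys)\<^sup>2"
      using e_nonzero 2(1) by (simp add: power_mult_distrib field_simps)
    then show ?thesis using 2(2) by (meson ereal_less_eq(3) order_trans)
  qed
qed

lemma B_fun_gt_conjugate:
  assumes norm_e: "norm e < 1 / sqrt 2" and a: "canon a = - A as" and nz: "e as \<noteq> 0"
  shows "conjugate (B_fun (skew_op A e)) as (- A as) < B_fun (skew_op A e) a as"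
proof -
  let ?c = "1 / (2 * (norm e)\<^sup>2)"
  have c: "1 < ?c"
    using two_norm_power2_less_one[OF norm_e] e_nonzero by simp
  have "conjugate (B_fun (skew_op A e)) as (- A as) \<le> ereal ((e as)\<^sup>2)"
    unfolding conjugate_def
  proof (rule SUP_least, clarify)
    fix y ys
    show "ereal (as y + (- A as) ys) - B_fun (skew_op A e) y ys \<le> ereal ((e as)\<^sup>2)"
    proof (cases "canon y = - A ys")
      case True
      \<comment> \<open>Constant 1 suffices for the conjugate; the excess of \<open>?c\<close> over
        1 yields the strict inequality at the end.\<close>
      have "(e ys)\<^sup>2 \<le> ?c * (e ys)\<^sup>2"
        using mult_right_mono[of 1 ?c "(e ys)\<^sup>2"] c by simp
      then have B: "ereal ((e ys)\<^sup>2) \<le> B_fun (skew_op A e) y ys"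
        using B_fun_lower[of ys y] by (simp add: order_trans[rotated])
      have "as y + (- A as) ys = - 2 * e as * e ys"
        using A_polar[of as ys] by (simp add: apply_graph[OF True] blinfun.bilinear_simps)
      \<comment> \<open>Completing the square: the difference of the two sides is the square of
        \<open>e as + e ys\<close>.\<close>
      also have "\<dots> - (e ys)\<^sup>2 \<le> (e as)\<^sup>2"
        using zero_le_power2[of "e as + e ys"] by (simp add: power2_sum)
      finally have "ereal (as y + (- A as) ys) - ereal ((e ys)\<^sup>2) \<le> ereal ((e as)\<^sup>2)"
        by simp
      then show ?thesis
        using ereal_minus_mono[OF order_refl B] order_trans by blast
    qed (simp add: B_fun_off_graph)
  qed
  also have "ereal ((e as)\<^sup>2) < ereal ((e as)\<^sup>2 / (2 * (norm e)\<^sup>2))"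
    using mult_strict_right_mono[OF c, of "(e as)\<^sup>2"] nz by simp
  also have "\<dots> \<le> B_fun (skew_op A e) a as" by (rule B_fun_lower)
  finally show ?thesis .
qed

end

theorem theorem4p11:
  fixes A :: "'a::banach dual \<Rightarrow>\<^sub>L 'a dual dual"
    and e :: "'a dual dual"
    and T :: "'a \<Rightarrow> 'a dual set"
  assumes ran_A: "range (blinfun_apply A) \<subseteq> range canon"
    and e_notin: "e \<notin> range canon"
    and norm_e: "norm e < 1 / sqrt 2"
    and A_e: "\<And>xs. blinfun_apply (blinfun_apply A xs) xs = (blinfun_apply e xs)\<^sup>2"
    and T_eq: "T = skew_op A e"
  shows "(\<lambda>(x, xs). (canon x, xs)) ` gra T
           = {(- skew_part A xs, xs) | xs. blinfun_apply e xs = 0}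
       \<and> {(- skew_part A xs, xs) | xs. blinfun_apply e xs = 0}
           = {(- blinfun_apply A xs, xs) | xs. blinfun_apply e xs = 0}
       \<and> (\<forall>a as. canon a = - blinfun_apply A as \<and> blinfun_apply e as \<noteq> 0 \<longrightarrow>
            B_fun T a as > conjugate (B_fun T) as (- blinfun_apply A as))
       \<and> \<not> autoconjugate (B_fun T)"
proof -
  interpret rank_one_symmetric_part A e
    by unfold_locales (use assms in auto)
  have gap: "conjugate (B_fun T) as (- A as) < B_fun T a as"
    if "canon a = - A as" "e as \<noteq> 0" for a as
    unfolding T_eq using norm_e that by (rule B_fun_gt_conjugate)
  have skew: "{(- skew_part A xs, xs) | xs. e xs = 0} = {(- A xs, xs) | xs. e xs = 0}"
    by (auto simp: skew_part_eq)
  have graph: "(\<lambda>(x, xs). (canon x, xs)) ` gra T = {(- A xs, xs) | xs. e xs = 0}"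
  proof (intro equalityI subsetI)
    fix p assume "p \<in> {(- A xs, xs) | xs. e xs = 0}"
    then obtain xs where p: "p = (- A xs, xs)" "e xs = 0" by blast
    obtain x where "canon x = - A xs" by (rule canon_preimage)
    then show "p \<in> (\<lambda>(x, xs). (canon x, xs)) ` gra T"
      unfolding T_eq using p by (intro image_eqI[of _ _ "(x, xs)"]) (auto simp: gra_skew_op)
  qed (auto simp: T_eq gra_skew_op)
  have "\<not> autoconjugate (B_fun T)"
  proof
    assume auto: "autoconjugate (B_fun T)"
    obtain as where as: "e as \<noteq> 0"
      using e_nonzero by (metis blinfun_eqI zero_blinfun.rep_eq)
    obtain a where a: "canon a = - A as" by (rule canon_preimage)
    \<comment> \<open>Since \<open>canon a\<close> is \<open>- A as\<close>, autoconjugacy would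
      force equality at a point where \<open>gap\<close> is strict.\<close>
    have "B_fun T a as = conjugate (B_fun T) as (canon a)"
      using auto by (simp add: autoconjugate_def conjugate_transpose_def)
    then show False using gap[OF a as] a by simp
  qed
  then show ?thesis using graph skew gap by simp
qed

end
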